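(* Let $s\in\mathbb R\setminus\{0\}$. (i) Let $\kappa\in so(n)$ and let $(\gamma(t),p(t))$ be a solution of the equations of motion $$\dot\gamma=p,\qquad \dot p=s\kappa p+\mu\gamma,\qquad \mu=s\langle p,\kappa\gamma\rangle-\langle p,p\rangle$$ on $T^*S^{n-1}=\{(\gamma,p)\in\mathbb R^{2n}\mid \langle\gamma,\gamma\rangle=1,\ \langle p,\gamma\rangle=0\}$. With $\Phi_s^{so(n)}=\gamma\wedge p+\frac{s}{2}(\kappa(\gamma\otimes\gamma)+(\gamma\otimes\gamma)\kappa)$, set, for $\lambda\neq 0$, $$\mathcal L(\lambda)=\lambda^2\frac{s^2}{4}\kappa^2+\lambda\,\Phi_s^{so(n)}+\gamma\otimes\gamma,\qquad \mathcal A(\lambda)=-\frac{s}{2}\kappa-\lambda^{-1}\gamma\otimes\gamma.$$ Then along the solution $\dot{\mathcal L}(\lambda)=[\mathcal L(\lambda),\mathcal A(\lambda)]$ for all $\lambda\ne 0$. (ii) Let $n=2\ell$, let $K=\operatorname{diag}(\kappa_{1,2},\kappa_{3,4},\dots,\kappa_{2\ell-1,2\ell})$ with $\kappa_{2i-1,2i}\ge 0$, and let $(z(t),w(t))$ be a solution of the equations of motion $$\dot z=w,\qquad \dot w=-\sqrt{-1}\,sKw+\mu z,\qquad \mu=\sqrt{-1}\,\frac{s}{2}\big(\langle Kw,\bar z\rangle-\langle z,K\bar w\rangle\big)-\langle w,\bar w\rangle$$ on $T^*S^{2\ell-1}=\{(z,w)\in\mathbb C^{2\ell}\mid \langle\bar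 z,z\rangle=1,\ \langle\bar w,z\rangle+\langle w,\bar z\rangle=0\}$. With $\Phi_s^{u(\ell)}=\frac12(w\otimes\bar z-z\otimes\bar w)+\sqrt{-1}\,\frac{s}{4}(K(z\otimes\bar z)+(z\otimes\bar z)K)$, set, for $\lambda\ne 0$, $$L(\lambda)=-\lambda^2\frac{s^2}{16}K^2+\lambda\,\Phi_s^{u(\ell)}+z\otimes\bar z,\qquad A(\lambda)=\sqrt{-1}\,\frac{s}{2}K+2\lambda^{-1}z\otimes\bar z.$$ Then along the solution $\dot L(\lambda)=[L(\lambda),A(\lambda)]$ for all $\lambda\neq0$.
   Context: Notation: for column vectors $x,y$, $x\otimes y=xy^T$ (matrix with entries $x_iy_j$) and $x\wedge y=x\otimes y-y\otimes x$. $\langle x,y\rangle=\sum_i x_iy_i$ is bilinear (also for complex vectors). $[\cdot,\cdot]$ is the matrix commutator and the dot is the time derivative along the solution. The equations in (i) describe the motion of a unit-mass point on the unit sphere $S^{n-1}\subset\mathbb R^n$ in the constant homogeneous magnetic field $s\sum_{i<j}\kappa_{ij}d\gamma_i\wedge d\gamma_j$. The equations in (ii) are those of (i) for $n=2\ell$ and $\kappa=\sum_{i=1}^{\ell}\kappa_{2i-1,2i}\,\mathbf e_{2i-1}\wedge\mathbf e_{2i}$ ($\mathbf e_j$ the standard basis), rewritten in the complex variables $z_i=\gamma_{2i-1}+\sqrt{-1}\gamma_{2i}$, $w_i=p_{2i-1}+\sqrt{-1}p_{2i}$. *)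

theory Defs
  imports "HOL-Analysis.Analysis"
begin

definition outer :: "'a::times ^ 'm \<Rightarrow> 'a ^ 'n \<Rightarrow> 'a ^ 'n ^ 'm"  (infixl "\<otimes>\<^sub>v" 71)
  where "x \<otimes>\<^sub>v y = (\<chi> i j. x $ i * y $ j)"

definition wedge :: "real ^ 'n \<Rightarrow> real ^ 'n \<Rightarrow> real ^ 'n ^ 'n"  (infixl "\<and>\<^sub>v" 71)
  where "x \<and>\<^sub>v y = x \<otimes>\<^sub>v y - y \<otimes>\<^sub>v x"

definition commutator :: "'a::ring_1 ^ 'n ^ 'n \<Rightarrow> 'a ^ 'n ^ 'n \<Rightarrow> 'a ^ 'n ^ 'n"
  where "commutator A B = A ** B - B ** A"

(* The inner product of the library on complex vectors is real-valued; this one is complex bilinear,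
   with no conjugation. *)
definition bilin :: "complex ^ 'n \<Rightarrow> complex ^ 'n \<Rightarrow> complex"
  where "bilin x y = (\<Sum>i\<in>UNIV. x $ i * y $ i)"

definition cnjv :: "complex ^ 'n \<Rightarrow> complex ^ 'n"
  where "cnjv x = (\<chi> i. cnj (x $ i))"

definition cscale :: "complex \<Rightarrow> complex ^ 'n ^ 'm \<Rightarrow> complex ^ 'n ^ 'm"  (infixr "*\<^sub>M" 75)
  where "c *\<^sub>M A = map_matrix ((*) c) A"

definition complexify :: "real ^ 'n ^ 'm \<Rightarrow> complex ^ 'n ^ 'm"
  where "complexify A = map_matrix complex_of_real A"

definition so_algebra :: "(real ^ 'n ^ 'n) set"
  where "so_algebra = {A. transpose A = - A}"

definition cdiag :: "real ^ 'l \<Rightarrow> complex ^ 'l ^ 'l"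
  where "cdiag k = (\<chi> i j. if i = j then complex_of_real (k $ i) else 0)"


definition cotangent_sphere :: "((real ^ 'n) \<times> (real ^ 'n)) set"
  where "cotangent_sphere = {(\<gamma>, p). \<gamma> \<bullet> \<gamma> = 1 \<and> p \<bullet> \<gamma> = 0}"

definition mu_real :: "real \<Rightarrow> real ^ 'n ^ 'n \<Rightarrow> real ^ 'n \<Rightarrow> real ^ 'n \<Rightarrow> real"
  where "mu_real s \<kappa> \<gamma> p = s * (p \<bullet> (\<kappa> *v \<gamma>)) - p \<bullet> p"

(* A solution lives on a set T of times. The derivative is taken within T: it is the ordinary one
   for an open interval and one-sided at an end point belonging to T. *)
definition real_solution ::
  "real \<Rightarrow> real ^ 'n ^ 'n \<Rightarrow> real set \<Rightarrow> (real \<Rightarrow> real ^ 'n) \<Rightarrow> (real \<Rightarrow> real ^ 'n) \<Rightarrow> bool"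
  where "real_solution s \<kappa> T \<gamma> p \<longleftrightarrow>
    (\<forall>t\<in>T. (\<gamma> t, p t) \<in> cotangent_sphere \<and>
      (\<gamma> has_vector_derivative p t) (at t within T) \<and>
      (p has_vector_derivative s *\<^sub>R (\<kappa> *v p t) + mu_real s \<kappa> (\<gamma> t) (p t) *\<^sub>R \<gamma> t) (at t within T))"

definition Phi_so :: "real \<Rightarrow> real ^ 'n ^ 'n \<Rightarrow> real ^ 'n \<Rightarrow> real ^ 'n \<Rightarrow> real ^ 'n ^ 'n"
  where "Phi_so s \<kappa> \<gamma> p =
    \<gamma> \<and>\<^sub>v p + (s / 2) *\<^sub>R (\<kappa> ** (\<gamma> \<otimes>\<^sub>v \<gamma>) + (\<gamma> \<otimes>\<^sub>v \<gamma>) ** \<kappa>)"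

(* The spectral parameter is complex, so the real coefficient matrices are complexified; real values
   of the parameter are a special case. *)
definition Lax_L_so ::
  "real \<Rightarrow> real ^ 'n ^ 'n \<Rightarrow> complex \<Rightarrow> real ^ 'n \<Rightarrow> real ^ 'n \<Rightarrow> complex ^ 'n ^ 'n"
  where "Lax_L_so s \<kappa> lam \<gamma> p =
    lam\<^sup>2 *\<^sub>M complexify ((s\<^sup>2 / 4) *\<^sub>R (\<kappa> ** \<kappa>)) + lam *\<^sub>M complexify (Phi_so s \<kappa> \<gamma> p)
      + complexify (\<gamma> \<otimes>\<^sub>v \<gamma>)"

definition Lax_A_so ::
  "real \<Rightarrow> real ^ 'n ^ 'n \<Rightarrow> complex \<Rightarrow> real ^ 'n \<Rightarrow> complex ^ 'n ^ 'n"
  where "Lax_A_so s \<kappa> lam \<gamma> =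
    complexify (- (s / 2) *\<^sub>R \<kappa>) - inverse lam *\<^sub>M complexify (\<gamma> \<otimes>\<^sub>v \<gamma>)"


definition complex_cotangent_sphere :: "((complex ^ 'l) \<times> (complex ^ 'l)) set"
  where "complex_cotangent_sphere =
    {(z, w). bilin (cnjv z) z = 1 \<and> bilin (cnjv w) z + bilin w (cnjv z) = 0}"

definition mu_complex :: "real \<Rightarrow> complex ^ 'l ^ 'l \<Rightarrow> complex ^ 'l \<Rightarrow> complex ^ 'l \<Rightarrow> complex"
  where "mu_complex s K z w =
    \<i> * complex_of_real (s / 2) * (bilin (K *v w) (cnjv z) - bilin z (K *v cnjv w))
      - bilin w (cnjv w)"

definition complex_solution ::
  "real \<Rightarrow> complex ^ 'l ^ 'l \<Rightarrow> real set \<Rightarrow> (real \<Rightarrow> complex ^ 'l) \<Rightarrow> (real \<Rightarrow> complex ^ 'l) \<Rightarrow> bool"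
  where "complex_solution s K T z w \<longleftrightarrow>
    (\<forall>t\<in>T. (z t, w t) \<in> complex_cotangent_sphere \<and>
      (z has_vector_derivative w t) (at t within T) \<and>
      (w has_vector_derivative
        (- \<i> * complex_of_real s) *s (K *v w t) + mu_complex s K (z t) (w t) *s z t) (at t within T))"

definition Phi_u :: "real \<Rightarrow> complex ^ 'l ^ 'l \<Rightarrow> complex ^ 'l \<Rightarrow> complex ^ 'l \<Rightarrow> complex ^ 'l ^ 'l"
  where "Phi_u s K z w =
    (1 / 2) *\<^sub>M (w \<otimes>\<^sub>v cnjv z - z \<otimes>\<^sub>v cnjv w)
      + (\<i> * complex_of_real (s / 4)) *\<^sub>M (K ** (z \<otimes>\<^sub>v cnjv z) + (z \<otimes>\<^sub>v cnjv z) ** K)"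

definition Lax_L_u ::
  "real \<Rightarrow> complex ^ 'l ^ 'l \<Rightarrow> complex \<Rightarrow> complex ^ 'l \<Rightarrow> complex ^ 'l \<Rightarrow> complex ^ 'l ^ 'l"
  where "Lax_L_u s K lam z w =
    - ((lam\<^sup>2 * complex_of_real (s\<^sup>2 / 16)) *\<^sub>M (K ** K)) + lam *\<^sub>M Phi_u s K z w + z \<otimes>\<^sub>v cnjv z"

definition Lax_A_u ::
  "real \<Rightarrow> complex ^ 'l ^ 'l \<Rightarrow> complex \<Rightarrow> complex ^ 'l \<Rightarrow> complex ^ 'l ^ 'l"
  where "Lax_A_u s K lam z =
    (\<i> * complex_of_real (s / 2)) *\<^sub>M K + (2 * inverse lam) *\<^sub>M (z \<otimes>\<^sub>v cnjv z)"

end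

theory Submission
  imports Defs
begin

text \<open>
  Both Lax pairs are instances of one identity. For a constant matrix \<open>B\<close>, a column vector \<open>x\<close>
  and a row vector \<open>y\<close> with velocities \<open>u\<close> and \<open>v\<close>, put \<open>Z = x \<otimes> y\<close> and
  \<open>D = u \<otimes> y - x \<otimes> v + B Z + Z B\<close>. If \<open>\<langle>y, x\<rangle> = 1\<close>, \<open>\<langle>v, x\<rangle> + \<langle>y, u\<rangle> = 0\<close>,
  \<open>u' = -2 B u + \<mu> x\<close> and \<open>v' = 2 v B + \<mu> y\<close>, then \<open>Z' = [D, Z] + [Z, B]\<close> and
  \<open>D' = [D, B] + [B\<^sup>2, Z]\<close>. These are the coefficients of \<open>\<nu>\<^sup>0\<close> and \<open>\<nu>\<^sup>1\<close> in the Lax equation for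
  \<open>\<nu>\<^sup>2 B\<^sup>2 + \<nu> D + Z\<close> and \<open>B + \<nu>\<^sup>-\<^sup>1 Z\<close>, and the other coefficients vanish.
  The case of \<open>so(n)\<close> is \<open>B = -s\<kappa>/2\<close>, \<open>\<nu> = -\<lambda>\<close>, \<open>y = x\<close>; the case of \<open>u(\<ell>)\<close> is
  \<open>B = \<i>sK/2\<close>, \<open>\<nu> = \<lambda>/2\<close>, \<open>y\<close> the conjugate of \<open>x\<close>.
\<close>

section \<open>Algebra of matrix products, commutators and complex scaling\<close>

lemma matrix_add_rdistrib: "(B + C) ** (A::'a::semiring_1^'n^'m) = B ** A + C ** A"
  by (simp add: matrix_matrix_mult_def vec_eq_iff distrib_right sum.distrib)

lemma matrix_diff_ldistrib: "(A::'a::ring_1^'n^'m) ** (B - C) = A ** B - A ** C"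
  by (simp add: matrix_matrix_mult_def vec_eq_iff right_diff_distrib sum_subtractf)

lemma matrix_diff_rdistrib: "(B - C) ** (A::'a::ring_1^'n^'m) = B ** A - C ** A"
  by (simp add: matrix_matrix_mult_def vec_eq_iff left_diff_distrib sum_subtractf)

lemma commutator_self [simp]: "commutator A A = 0"
  by (simp add: commutator_def)

lemma commutator_add_left: "commutator (A + B) C = commutator A C + commutator B C"
  by (simp add: commutator_def matrix_add_rdistrib matrix_add_ldistrib)

lemma commutator_add_right: "commutator A (B + C) = commutator A B + commutator A C"
  by (simp add: commutator_def matrix_add_rdistrib matrix_add_ldistrib)

lemma matrix_mult_cscale_left: "(c *\<^sub>M A) ** B = c *\<^sub>M (A ** B)"
  by (simp add: cscale_def matrix_matrix_mult_def vec_eq_iff sum_distrib_left mult_ac)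

lemma matrix_mult_cscale_right: "A ** (c *\<^sub>M B) = c *\<^sub>M (A ** B)"
  by (simp add: cscale_def matrix_matrix_mult_def vec_eq_iff sum_distrib_left mult_ac)

lemma cscale_add_right: "c *\<^sub>M (A + B) = c *\<^sub>M A + c *\<^sub>M B"
  by (simp add: cscale_def vec_eq_iff distrib_left)

lemma cscale_add_left: "(c + d) *\<^sub>M A = c *\<^sub>M A + d *\<^sub>M A"
  by (simp add: cscale_def vec_eq_iff distrib_right)

lemma cscale_diff_right: "c *\<^sub>M (A - B) = c *\<^sub>M A - c *\<^sub>M B"
  by (simp add: cscale_def vec_eq_iff right_diff_distrib)

lemma cscale_minus_left [simp]: "(- c) *\<^sub>M A = - (c *\<^sub>M A)"
  by (simp add: cscale_def vec_eq_iff)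

lemma cscale_cscale [simp]: "c *\<^sub>M d *\<^sub>M A = (c * d) *\<^sub>M A"
  by (simp add: cscale_def vec_eq_iff)

lemma cscale_one [simp]: "1 *\<^sub>M A = A"
  by (simp add: cscale_def vec_eq_iff)

lemma cscale_zero_right [simp]: "c *\<^sub>M 0 = 0"
  by (simp add: cscale_def vec_eq_iff)

lemma cscale_minus_right [simp]: "c *\<^sub>M (- A) = - (c *\<^sub>M A)"
  by (simp add: cscale_def vec_eq_iff)

lemma commutator_cscale_left: "commutator (c *\<^sub>M A) B = c *\<^sub>M commutator A B"
  by (simp add: commutator_def matrix_mult_cscale_left matrix_mult_cscale_right cscale_diff_right)

lemma commutator_cscale_right: "commutator A (c *\<^sub>M B) = c *\<^sub>M commutator A B"
  by (simp add: commutator_def matrix_mult_cscale_left matrix_mult_cscale_right cscale_diff_right)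

section \<open>Products of rank-one matrices\<close>

lemma matrix_mult_outer: "A ** (x \<otimes>\<^sub>v y) = (A *v x) \<otimes>\<^sub>v (y :: complex ^ 'n)"
  by (simp add: outer_def matrix_matrix_mult_def matrix_vector_mult_def vec_eq_iff
      sum_distrib_right mult.assoc)

lemma outer_mult_matrix: "(x \<otimes>\<^sub>v y) ** A = x \<otimes>\<^sub>v (y v* (A :: complex ^ 'n ^ 'm))"
  by (simp add: outer_def matrix_matrix_mult_def vector_matrix_mult_def vec_eq_iff
      sum_distrib_left mult_ac)

lemma outer_mult_outer: "(x \<otimes>\<^sub>v y) ** (u \<otimes>\<^sub>v v) = bilin y u *\<^sub>M (x \<otimes>\<^sub>v v)"
  by (simp add: outer_def matrix_matrix_mult_def bilin_def cscale_def vec_eq_iff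
      sum_distrib_left sum_distrib_right mult_ac)

lemma outer_add_left: "(x + y) \<otimes>\<^sub>v z = x \<otimes>\<^sub>v z + y \<otimes>\<^sub>v (z :: complex ^ 'n)"
  by (simp add: outer_def vec_eq_iff algebra_simps)

lemma outer_add_right: "z \<otimes>\<^sub>v (x + y) = z \<otimes>\<^sub>v x + z \<otimes>\<^sub>v (y :: complex ^ 'n)"
  by (simp add: outer_def vec_eq_iff algebra_simps)

lemma outer_scale_left: "(c *s x) \<otimes>\<^sub>v y = c *\<^sub>M (x \<otimes>\<^sub>v y)"
  by (simp add: outer_def vec_eq_iff cscale_def)

lemma outer_scale_right: "x \<otimes>\<^sub>v (c *s y) = c *\<^sub>M (x \<otimes>\<^sub>v y)"
  by (simp add: outer_def vec_eq_iff cscale_def)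

section \<open>Boundedness of the operations to be differentiated, automatic in finite
  dimension\<close>

lemma bounded_bilinear_outer:
  "bounded_bilinear (\<lambda>(x :: complex ^ 'm) (y :: complex ^ 'n). x \<otimes>\<^sub>v y)"
  unfolding bilinear_conv_bounded_bilinear[symmetric] bilinear_def
  by (auto intro!: linearI simp: outer_def vec_eq_iff algebra_simps)

lemma bounded_linear_matrix_mult_right:
  "bounded_linear (\<lambda>X :: complex ^ 'k ^ 'n. (A :: complex ^ 'n ^ 'm) ** X)"
  unfolding linear_conv_bounded_linear[symmetric]
  by (rule linearI) (simp_all add: matrix_matrix_mult_def vec_eq_iff algebra_simps sum.distrib
      scaleR_sum_right)

lemma bounded_linear_matrix_mult_left:
  "bounded_linear (\<lambda>X :: complex ^ 'n ^ 'm. X ** (A :: complex ^ 'k ^ 'n))"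
  unfolding linear_conv_bounded_linear[symmetric]
  by (rule linearI) (simp_all add: matrix_matrix_mult_def vec_eq_iff algebra_simps sum.distrib
      scaleR_sum_right)

lemma bounded_linear_cscale: "bounded_linear (\<lambda>X :: complex ^ 'n ^ 'm. c *\<^sub>M X)"
  unfolding linear_conv_bounded_linear[symmetric]
  by (rule linearI) (simp_all add: cscale_def vec_eq_iff algebra_simps)

text \<open>Conjugation is real-linear though not complex-linear; since time is real, this suffices
  to pull it through the derivative.\<close>

lemma bounded_linear_cnjv: "bounded_linear (cnjv :: complex ^ 'n \<Rightarrow> _)"
  unfolding linear_conv_bounded_linear[symmetric]
  by (rule linearI) (simp_all add: cnjv_def vec_eq_iff)

section \<open>Complexification, which carries the real system into the complex identity\<close>

definition complexifyv :: "real ^ 'n \<Rightarrow> complex ^ 'n"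
  where "complexifyv x = (\<chi> i. complex_of_real (x $ i))"

lemma bounded_linear_complexifyv: "bounded_linear (complexifyv :: real ^ 'n \<Rightarrow> _)"
  unfolding linear_conv_bounded_linear[symmetric]
  by (rule linearI) (simp_all add: complexifyv_def vec_eq_iff scaleR_conv_of_real[where 'a = complex])

lemma complexifyv_add: "complexifyv (x + y) = complexifyv x + complexifyv y"
  by (simp add: complexifyv_def vec_eq_iff)

lemma complexifyv_scaleR: "complexifyv (c *\<^sub>R x) = complex_of_real c *s complexifyv x"
  by (simp add: complexifyv_def vec_eq_iff)

lemma complexifyv_mult: "complexifyv (A *v x) = complexify A *v complexifyv x"
  by (simp add: complexifyv_def complexify_def matrix_vector_mult_def vec_eq_iff)

lemma bilin_complexifyv: "bilin (complexifyv x) (complexifyv y) = complex_of_real (x \<bullet> y)"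
  by (simp add: complexifyv_def bilin_def inner_vec_def)

lemma complexify_outer: "complexify (x \<otimes>\<^sub>v y) = complexifyv x \<otimes>\<^sub>v complexifyv y"
  by (simp add: complexifyv_def complexify_def outer_def vec_eq_iff)

lemma complexify_add: "complexify (A + B) = complexify A + complexify B"
  by (simp add: complexify_def vec_eq_iff)

lemma complexify_diff: "complexify (A - B) = complexify A - complexify B"
  by (simp add: complexify_def vec_eq_iff)

lemma complexify_scaleR: "complexify (c *\<^sub>R A) = complex_of_real c *\<^sub>M complexify A"
  by (simp add: complexify_def cscale_def vec_eq_iff)

lemma complexify_mult: "complexify (A ** B) = complexify A ** complexify B"
  by (simp add: complexify_def matrix_matrix_mult_def vec_eq_iff)

text \<open>Skew-symmetry exchanges the row action for minus the column action. This lets the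
  equation for \<open>p\<close>, given in column form, also serve as the row equation
  \<open>v' = 2 v B + \<mu> y\<close>.\<close>

lemma so_algebra_vector_mult:
  assumes "\<kappa> \<in> so_algebra"
  shows "complexifyv p v* complexify \<kappa> = - complexifyv (\<kappa> *v p)"
proof -
  have skew: "\<kappa> $ i $ j = - (\<kappa> $ j $ i)" for i j
  proof -
    have "\<kappa> $ i $ j = transpose \<kappa> $ j $ i"
      by (simp add: transpose_def)
    also have "\<dots> = - (\<kappa> $ j $ i)"
      using assms by (simp add: so_algebra_def)
    finally show ?thesis .
  qed
  have "p $ i * \<kappa> $ i $ j = - (\<kappa> $ j $ i * p $ i)" for i j
    by (subst skew) simp
  then have "(\<Sum>i\<in>UNIV. p $ i * \<kappa> $ i $ j) = - (\<Sum>i\<in>UNIV. \<kappa> $ j $ i * p $ i)" for j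
    by (simp only: sum_negf)
  from arg_cong[OF this, of complex_of_real]
  have "(complexifyv p v* complexify \<kappa>) $ j = (- complexifyv (\<kappa> *v p)) $ j" for j
    by (simp add: complexifyv_def complexify_def matrix_vector_mult_def vector_matrix_mult_def
        mult.commute)
  then show ?thesis
    by (simp add: vec_eq_iff)
qed

section \<open>The common Lax identity\<close>

definition shifted_momentum ::
  "complex ^ 'n ^ 'n \<Rightarrow> complex ^ 'n \<Rightarrow> complex ^ 'n \<Rightarrow> complex ^ 'n \<Rightarrow> complex ^ 'n \<Rightarrow> complex ^ 'n ^ 'n"
  where "shifted_momentum B x y u v =
    u \<otimes>\<^sub>v y - x \<otimes>\<^sub>v v + B ** (x \<otimes>\<^sub>v y) + (x \<otimes>\<^sub>v y) ** B"

text \<open>The first constraint makes \<open>Z = x \<otimes> y\<close> idempotent, so the part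
  \<open>B Z + Z B\<close> contributes \<open>B Z - Z B\<close>, which cancels against
  \<open>[Z, B]\<close>. In \<open>[u \<otimes> y - x \<otimes> v, Z]\<close> the multiples of
  \<open>Z\<close> add up to \<open>- (\<langle>v, x\<rangle> + \<langle>y, u\<rangle>) Z\<close>,
  which vanishes by the second constraint.\<close>

lemma commutator_shifted_momentum_outer:
  assumes "bilin y x = 1" and "bilin v x + bilin y u = 0"
  shows "commutator (shifted_momentum B x y u v) (x \<otimes>\<^sub>v y) + commutator (x \<otimes>\<^sub>v y) B
    = u \<otimes>\<^sub>v y + x \<otimes>\<^sub>v v"
proof -
  let ?Z = "x \<otimes>\<^sub>v y"
  have v: "bilin v x = - bilin y u"
    using assms(2) by (simp add: eq_neg_iff_add_eq_0)
  \<comment> \<open>Idempotency of \<open>Z\<close> in the bracketings produced by expansion; the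
    last equation only reassociates, so that the two copies of \<open>Z B Z\<close> cancel.\<close>
  have *: "(B ** ?Z) ** ?Z = B ** ?Z" "?Z ** (?Z ** B) = ?Z ** B" "(?Z ** B) ** ?Z = ?Z ** (B ** ?Z)"
    by (simp_all only: matrix_mul_assoc[of ?Z ?Z] matrix_mul_assoc[of B ?Z ?Z, symmetric]
        matrix_mul_assoc[of ?Z B ?Z, symmetric] outer_mult_outer assms(1) cscale_one)
  show ?thesis
    by (simp add: shifted_momentum_def commutator_def matrix_add_ldistrib matrix_add_rdistrib
        matrix_diff_ldistrib matrix_diff_rdistrib outer_mult_outer assms(1) v *)
qed

text \<open>In \<open>[B Z + Z B, B]\<close> the two copies of \<open>B Z B\<close> cancel, leaving
  \<open>- [B ** B, Z]\<close>.\<close>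

lemma commutator_shifted_momentum:
  "commutator (shifted_momentum B x y u v) B + commutator (B ** B) (x \<otimes>\<^sub>v y)
    = commutator (u \<otimes>\<^sub>v y - x \<otimes>\<^sub>v v) B"
  by (simp add: shifted_momentum_def commutator_def matrix_add_ldistrib matrix_add_rdistrib
      matrix_diff_ldistrib matrix_diff_rdistrib matrix_mul_assoc)

text \<open>The product rule gives the derivatives of \<open>Z\<close> and \<open>D\<close>, and the
  two preceding identities turn them into commutators. Keeping \<open>y\<close> separate from
  \<open>x\<close> covers both a vector paired with itself and one paired with its
  conjugate.\<close>

lemma has_vector_derivative_Lax:
  fixes x y u v :: "real \<Rightarrow> complex ^ 'n" and B :: "complex ^ 'n ^ 'n"
  assumes "\<nu> \<noteq> 0" and "bilin (y t) (x t) = 1" and "bilin (v t) (x t) + bilin (y t) (u t) = 0"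
    and x: "(x has_vector_derivative u t) (at t within T)"
    and y: "(y has_vector_derivative v t) (at t within T)"
    and u: "(u has_vector_derivative (- 2) *s (B *v u t) + \<mu> *s x t) (at t within T)"
    and v: "(v has_vector_derivative 2 *s (v t v* B) + \<mu> *s y t) (at t within T)"
  shows "((\<lambda>\<tau>. \<nu>\<^sup>2 *\<^sub>M (B ** B) + \<nu> *\<^sub>M shifted_momentum B (x \<tau>) (y \<tau>) (u \<tau>) (v \<tau>) + x \<tau> \<otimes>\<^sub>v y \<tau>)
    has_vector_derivative
      commutator (\<nu>\<^sup>2 *\<^sub>M (B ** B) + \<nu> *\<^sub>M shifted_momentum B (x t) (y t) (u t) (v t) + x t \<otimes>\<^sub>v y t)
        (B + inverse \<nu> *\<^sub>M (x t \<otimes>\<^sub>v y t)))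
    (at t within T)"
proof -
  note outer_deriv = bounded_bilinear.has_vector_derivative[OF bounded_bilinear_outer]
  let ?Z = "x t \<otimes>\<^sub>v y t" and ?W = "u t \<otimes>\<^sub>v y t" and ?V = "x t \<otimes>\<^sub>v v t"
  let ?D = "shifted_momentum B (x t) (y t) (u t) (v t)"
  have Z: "((\<lambda>\<tau>. x \<tau> \<otimes>\<^sub>v y \<tau>) has_vector_derivative ?V + ?W) (at t within T)"
    by (rule outer_deriv[OF x y])
  have D: "((\<lambda>\<tau>. shifted_momentum B (x \<tau>) (y \<tau>) (u \<tau>) (v \<tau>)) has_vector_derivative
      (u t \<otimes>\<^sub>v v t + ((- 2) *s (B *v u t) + \<mu> *s x t) \<otimes>\<^sub>v y t)
      - (x t \<otimes>\<^sub>v (2 *s (v t v* B) + \<mu> *s y t) + u t \<otimes>\<^sub>v v t)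
      + B ** (?V + ?W) + (?V + ?W) ** B) (at t within T)"
    unfolding shifted_momentum_def
    by (intro has_vector_derivative_add has_vector_derivative_diff outer_deriv x y u v
        bounded_linear.has_vector_derivative[OF bounded_linear_matrix_mult_left]
        bounded_linear.has_vector_derivative[OF bounded_linear_matrix_mult_right] Z)
  \<comment> \<open>Writing the factor 2 as a sum reduces the next computation to cancellation in an
    additive group.\<close>
  have two: "2 *\<^sub>M A = A + A" for A :: "complex ^ 'n ^ 'n"
    by (metis cscale_add_left cscale_one one_add_one)
  \<comment> \<open>The terms \<open>u \<otimes> v\<close> cancel, and so do the two terms
    \<open>\<mu> Z\<close>, because the same \<mu> occurs in both equations. What remains is
    \<open>- 2 B W - 2 V B + B (V + W) + (V + W) B\<close>.\<close>
  have "(u t \<otimes>\<^sub>v v t + ((- 2) *s (B *v u t) + \<mu> *s x t) \<otimes>\<^sub>v y t)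
      - (x t \<otimes>\<^sub>v (2 *s (v t v* B) + \<mu> *s y t) + u t \<otimes>\<^sub>v v t)
      + B ** (?V + ?W) + (?V + ?W) ** B = commutator (?W - ?V) B"
    unfolding outer_add_left outer_add_right outer_scale_left outer_scale_right cscale_minus_left two
      matrix_mult_outer[symmetric] outer_mult_matrix[symmetric]
    by (simp add: commutator_def matrix_add_ldistrib matrix_add_rdistrib
        matrix_diff_ldistrib matrix_diff_rdistrib)
  also have "\<dots> = commutator ?D B + commutator (B ** B) ?Z"
    by (rule commutator_shifted_momentum[symmetric])
  finally have D': "((\<lambda>\<tau>. shifted_momentum B (x \<tau>) (y \<tau>) (u \<tau>) (v \<tau>)) has_vector_derivative
      commutator ?D B + commutator (B ** B) ?Z) (at t within T)"
    using D by simp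
  have "?V + ?W = commutator ?D ?Z + commutator ?Z B"
    using commutator_shifted_momentum_outer[OF assms(2,3)] by (simp add: add.commute)
  then have Z': "((\<lambda>\<tau>. x \<tau> \<otimes>\<^sub>v y \<tau>) has_vector_derivative
      commutator ?D ?Z + commutator ?Z B) (at t within T)"
    using Z by simp
  have \<nu>: "inverse \<nu> * \<nu>\<^sup>2 = \<nu>"
    using \<open>\<nu> \<noteq> 0\<close> by (simp add: power2_eq_square)
  have BB: "commutator (B ** B) B = 0"
    by (simp add: commutator_def matrix_mul_assoc)
  \<comment> \<open>Expansion in powers of \<nu>: the extreme coefficients are
    \<open>[B ** B, B] = 0\<close> and \<open>[Z, Z] = 0\<close>, and \<open>[B ** B, Z]\<close>
    drops to first order through the factor \<open>inverse \<nu>\<close>. The explicit 0 is kept as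
    the derivative of the constant term.\<close>
  have "commutator (\<nu>\<^sup>2 *\<^sub>M (B ** B) + \<nu> *\<^sub>M ?D + ?Z) (B + inverse \<nu> *\<^sub>M ?Z)
      = 0 + \<nu> *\<^sub>M (commutator ?D B + commutator (B ** B) ?Z) + (commutator ?D ?Z + commutator ?Z B)"
    using \<open>\<nu> \<noteq> 0\<close> \<nu>
    by (simp add: commutator_add_left commutator_add_right commutator_cscale_left
        commutator_cscale_right BB cscale_add_right)
  then show ?thesis
    by (simp only:) (intro has_vector_derivative_add has_vector_derivative_const
        bounded_linear.has_vector_derivative[OF bounded_linear_cscale] D' Z')
qed

section \<open>The real system on so(n)\<close>

lemma Lax_so:
  assumes "\<kappa> \<in> so_algebra" and "real_solution s \<kappa> T \<gamma> p" and "lam \<noteq> 0" and "t \<in> T"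
  shows "((\<lambda>\<tau>. Lax_L_so s \<kappa> lam (\<gamma> \<tau>) (p \<tau>)) has_vector_derivative
    commutator (Lax_L_so s \<kappa> lam (\<gamma> t) (p t)) (Lax_A_so s \<kappa> lam (\<gamma> t))) (at t within T)"
proof -
  define B where "B = complexify (- (s / 2) *\<^sub>R \<kappa>)"
  let ?x = "\<lambda>\<tau>. complexifyv (\<gamma> \<tau>)" and ?u = "\<lambda>\<tau>. complexifyv (p \<tau>)"
  let ?\<mu> = "complex_of_real (mu_real s \<kappa> (\<gamma> t) (p t))"
  note complexifyv_deriv = bounded_linear.has_vector_derivative[OF bounded_linear_complexifyv]
  have sphere: "\<gamma> t \<bullet> \<gamma> t = 1" "p t \<bullet> \<gamma> t = 0"
    and x: "(\<gamma> has_vector_derivative p t) (at t within T)"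
    and u: "(p has_vector_derivative s *\<^sub>R (\<kappa> *v p t) + mu_real s \<kappa> (\<gamma> t) (p t) *\<^sub>R \<gamma> t)
      (at t within T)"
    using assms(2,4) by (auto simp: real_solution_def cotangent_sphere_def)
  have "complexifyv (s *\<^sub>R (\<kappa> *v p t) + mu_real s \<kappa> (\<gamma> t) (p t) *\<^sub>R \<gamma> t)
      = (- 2) *s (B *v ?u t) + ?\<mu> *s ?x t"
    unfolding B_def complexifyv_mult[symmetric]
    by (simp add: complexifyv_add complexifyv_scaleR matrix_vector_mult_def vec_eq_iff
        complexifyv_def sum_distrib_left sum_negf mult_ac)
  then have 1: "(?u has_vector_derivative (- 2) *s (B *v ?u t) + ?\<mu> *s ?x t) (at t within T)"
    using complexifyv_deriv[OF u] by simp
  have "- (s / 2) *\<^sub>R \<kappa> \<in> so_algebra"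
    using assms(1) by (simp only: so_algebra_def mem_Collect_eq transpose_scalar scaleR_minus_right)
  then have "?u t v* B = - (B *v ?u t)"
    unfolding B_def by (simp only: so_algebra_vector_mult complexifyv_mult)
  then have "(- 2) *s (B *v ?u t) = 2 *s (?u t v* B)"
    by (simp add: vec_eq_iff)
  with 1 have 2: "(?u has_vector_derivative 2 *s (?u t v* B) + ?\<mu> *s ?x t) (at t within T)"
    by (simp only:)
  \<comment> \<open>With the single constant \<open>c\<close> one has \<open>s = - 2 c\<close> and
    hence \<open>s\<^sup>2 / 4 = c\<^sup>2\<close>, so both sides of \<open>L\<close> become
    polynomials in \<open>c\<close>.\<close>
  define c where "c = complex_of_real (- (s / 2))"
  have c: "complex_of_real s = - (2 * c)"
    by (simp add: c_def)
  have B: "B = c *\<^sub>M complexify \<kappa>"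
    unfolding B_def c_def by (rule complexify_scaleR)
  \<comment> \<open>Here the shifted momentum is minus the complexified \<open>Phi_so\<close>, as
    \<open>u \<otimes> x - x \<otimes> u\<close> is the reversed wedge; this is the source of the
    sign in \<open>\<nu> = - lam\<close>.\<close>
  have L: "Lax_L_so s \<kappa> lam g q = (- lam)\<^sup>2 *\<^sub>M (B ** B)
      + (- lam) *\<^sub>M shifted_momentum B (complexifyv g) (complexifyv g) (complexifyv q) (complexifyv q)
      + complexifyv g \<otimes>\<^sub>v complexifyv g" for g q
    by (simp add: Lax_L_so_def Phi_so_def wedge_def shifted_momentum_def B complexify_add
        complexify_diff complexify_scaleR complexify_mult complexify_outer cscale_add_right
        cscale_diff_right matrix_mult_cscale_left matrix_mult_cscale_right power2_eq_square
        c mult_ac)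
  have A: "Lax_A_so s \<kappa> lam g = B + inverse (- lam) *\<^sub>M (complexifyv g \<otimes>\<^sub>v complexifyv g)" for g
    by (simp add: Lax_A_so_def B_def complexify_outer)
  show ?thesis
    unfolding L A
  proof (rule has_vector_derivative_Lax[OF _ _ _ complexifyv_deriv[OF x] complexifyv_deriv[OF x] 1 2])
    show "- lam \<noteq> 0"
      using \<open>lam \<noteq> 0\<close> by simp
    show "bilin (?x t) (?x t) = 1"
      by (simp add: bilin_complexifyv sphere)
    show "bilin (?u t) (?x t) + bilin (?x t) (?u t) = 0"
      by (simp add: bilin_complexifyv sphere inner_commute[of "\<gamma> t"])
  qed
qed

section \<open>The complex system on u(l)\<close>

lemma Lax_u:
  assumes "K = cdiag k" and "complex_solution s K T z w" and "lam \<noteq> 0" and "t \<in> T"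
  shows "((\<lambda>\<tau>. Lax_L_u s K lam (z \<tau>) (w \<tau>)) has_vector_derivative
    commutator (Lax_L_u s K lam (z t) (w t)) (Lax_A_u s K lam (z t))) (at t within T)"
proof -
  define B where "B = (\<i> * complex_of_real (s / 2)) *\<^sub>M K"
  let ?\<mu> = "mu_complex s K (z t) (w t)"
  note cnjv_deriv = bounded_linear.has_vector_derivative[OF bounded_linear_cnjv]
  have sphere: "bilin (cnjv (z t)) (z t) = 1"
      "bilin (cnjv (w t)) (z t) + bilin (w t) (cnjv (z t)) = 0"
    and z: "(z has_vector_derivative w t) (at t within T)"
    and w: "(w has_vector_derivative (- \<i> * complex_of_real s) *s (K *v w t) + ?\<mu> *s z t)
      (at t within T)"
    using assms(2,4) by (auto simp: complex_solution_def complex_cotangent_sphere_def)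
  have bilin_commute: "bilin a b = bilin b a" for a b :: "complex ^ 'k"
    by (simp add: bilin_def mult.commute)
  \<comment> \<open>Since \<open>K\<close> is diagonal with real entries, its row and column actions
    agree and commute with conjugation.\<close>
  have K_mult: "(K *v a) $ i = complex_of_real (k $ i) * a $ i" for a i
    by (simp add: assms(1) cdiag_def matrix_vector_mult_def
        if_distrib[where f = "\<lambda>c. c * _"] cong: if_cong)
  have mult_K: "(a v* K) $ i = complex_of_real (k $ i) * a $ i" for a i
    by (simp add: assms(1) cdiag_def vector_matrix_mult_def
        if_distrib[where f = "\<lambda>c. _ * c"] cong: if_cong)
  have B_mult: "B *v a = (\<i> * complex_of_real (s / 2)) *s (K *v a)" for a
    by (simp add: B_def cscale_def matrix_vector_mult_def vec_eq_iff sum_distrib_left mult_ac)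
  have mult_B: "a v* B = (\<i> * complex_of_real (s / 2)) *s (a v* K)" for a
    by (simp add: B_def cscale_def vector_matrix_mult_def vec_eq_iff sum_distrib_left mult_ac)
  \<comment> \<open>\<open>\<langle>K w, cnj z\<rangle> - \<langle>z, K (cnj w)\<rangle>\<close> is
    a number minus its conjugate, so multiplication by \<i> makes it real. Reality of \<mu> ensures
    that the conjugate equation carries the same multiplier.\<close>
  have \<mu>: "cnj ?\<mu> = ?\<mu>"
    by (simp add: mu_complex_def bilin_def cnjv_def K_mult algebra_simps)
  have 1: "(w has_vector_derivative (- 2) *s (B *v w t) + ?\<mu> *s z t) (at t within T)"
    using w by (simp add: B_mult)
  \<comment> \<open>Conjugation changes \<open>- \<i> s K\<close> into \<open>\<i> s K\<close>,
    which is \<open>2 B\<close>, now acting on the right of a row vector.\<close>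
  have "cnjv ((- \<i> * complex_of_real s) *s (K *v w t) + ?\<mu> *s z t)
      = 2 *s (cnjv (w t) v* B) + ?\<mu> *s cnjv (z t)"
    by (simp add: mult_B vec_eq_iff mult_K cnjv_def K_mult \<mu>)
  then have 2: "((\<lambda>\<tau>. cnjv (w \<tau>)) has_vector_derivative
      2 *s (cnjv (w t) v* B) + ?\<mu> *s cnjv (z t)) (at t within T)"
    using cnjv_deriv[OF w] by simp
  \<comment> \<open>Here the shifted momentum is \<open>2 Phi_u\<close>, hence
    \<open>\<nu> = lam / 2\<close>; the quadratic terms agree because \<open>B ** B\<close> is
    \<open>- s\<^sup>2 / 4\<close> times \<open>K ** K\<close>.\<close>
  have L: "Lax_L_u s K lam a b = (lam / 2)\<^sup>2 *\<^sub>M (B ** B)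
      + (lam / 2) *\<^sub>M shifted_momentum B a (cnjv a) b (cnjv b) + a \<otimes>\<^sub>v cnjv a" for a b
    by (simp add: Lax_L_u_def Phi_u_def shifted_momentum_def B_def cscale_add_right
        cscale_diff_right matrix_mult_cscale_left matrix_mult_cscale_right power2_eq_square mult_ac)
  have A: "Lax_A_u s K lam a = B + inverse (lam / 2) *\<^sub>M (a \<otimes>\<^sub>v cnjv a)" for a
    by (simp add: Lax_A_u_def B_def field_simps)
  show ?thesis
    unfolding L A
  proof (rule has_vector_derivative_Lax[OF _ _ _ z cnjv_deriv[OF z] 1 2])
    show "lam / 2 \<noteq> 0"
      using \<open>lam \<noteq> 0\<close> by simp
    show "bilin (cnjv (z t)) (z t) = 1"
      by (rule sphere)
    show "bilin (cnjv (w t)) (z t) + bilin (cnjv (z t)) (w t) = 0"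
      using sphere(2) by (simp only: bilin_commute[of "w t" "cnjv (z t)"])
  qed
qed

theorem theorem1:
  fixes s :: real
  assumes "s \<noteq> 0"
  shows "(\<forall>(\<kappa> :: real ^ 'n ^ 'n) T \<gamma> p.
            \<kappa> \<in> so_algebra \<longrightarrow> is_interval T \<longrightarrow> real_solution s \<kappa> T \<gamma> p \<longrightarrow>
            (\<forall>lam :: complex. lam \<noteq> 0 \<longrightarrow> (\<forall>t\<in>T.
              ((\<lambda>\<tau>. Lax_L_so s \<kappa> lam (\<gamma> \<tau>) (p \<tau>)) has_vector_derivative
                 commutator (Lax_L_so s \<kappa> lam (\<gamma> t) (p t)) (Lax_A_so s \<kappa> lam (\<gamma> t)))
                (at t within T))))
       \<and> (\<forall>(k :: real ^ 'l) K T z w.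
            (\<forall>i. 0 \<le> k $ i) \<longrightarrow> K = cdiag k \<longrightarrow> is_interval T \<longrightarrow> complex_solution s K T z w \<longrightarrow>
            (\<forall>lam :: complex. lam \<noteq> 0 \<longrightarrow> (\<forall>t\<in>T.
              ((\<lambda>\<tau>. Lax_L_u s K lam (z \<tau>) (w \<tau>)) has_vector_derivative
                 commutator (Lax_L_u s K lam (z t) (w t)) (Lax_A_u s K lam (z t)))
                (at t within T))))"
  by (intro conjI allI impI ballI) (erule (3) Lax_so, erule (3) Lax_u)

end
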